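(* Let $X$ be a Banach space and $1\le p<2$. If $X$ is of weak Haar type $p$, then $X$ is of Haar type $r$ for every $r<p$ (with $1\le r$).
   Context: Dyadic intervals: for $k\ge 0$ and integers $j$, $\Delta_k^{(j)}:=[\frac{j-1}{2^k},\frac{j}{2^k})$. Haar functions: for $k=1,2,\dots$ and integers $j$, $\chi_k^{(j)}(t)=+2^{(k-1)/2}$ if $t\in\Delta_k^{(2j-1)}$, $-2^{(k-1)/2}$ if $t\in\Delta_k^{(2j)}$, and $0$ otherwise ($t\in[0,1)$). For an $X$-valued function $f$ on $[0,1)$, $\|f|L_q\|$ denotes its Bochner $L_q([0,1),X)$ norm. For $1\le r\le 2$, $X$ is of Haar type $r$ if there is $c\ge0$ such that $$\Big\|\sum_{k=1}^n\sum_{j=1}^{2^{k-1}}x_k^{(j)}\chi_k^{(j)}\Big|L_r\Big\|\le c\Big(\sum_{k=1}^n\Big\|\sum_{j=1}^{2^{k-1}}x_k^{(j)}\chi_k^{(j)}\Big|L_r\Big\|^r\Big)^{1/r}$$ for all $n\in\mathbb N$ and all $x_k^{(j)}\in X$. For $1\le p<2$, $X$ is of weak Haar type $p$ if there is $c\ge0$ such that $$\Big\|\sum_{k=1}^n\sum_{j=1}^{2^{k-1}}x_k^{(j)}\chi_k^{(j)}\Big|L_2\Big\|\le c\,n^{1/p-1/2}\Big(\sum_{k=1}^n\Big\|\sum_{j=1}^{2^{k-1}}x_k^{(j)}\chi_k^{(j)}\Big|L_2\Big\|^2\Big)^{1/2}$$ for all $n\in\mathbb N$ and all $x_k^{(j)}\in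 X$. *)

theory Defs
  imports "HOL-Analysis.Analysis"
begin

definition dyadic_interval :: "nat \<Rightarrow> int \<Rightarrow> real set" where
  "dyadic_interval k j = {real_of_int (j - 1) / 2 ^ k ..< real_of_int j / 2 ^ k}"

definition haar :: "nat \<Rightarrow> int \<Rightarrow> real \<Rightarrow> real" where
  "haar k j t =
     (if t \<in> {0..<1} \<and> t \<in> dyadic_interval k (2 * j - 1) then 2 powr ((real k - 1) / 2)
      else if t \<in> {0..<1} \<and> t \<in> dyadic_interval k (2 * j) then - (2 powr ((real k - 1) / 2))
      else 0)"

definition Lq_norm :: "real \<Rightarrow> (real \<Rightarrow> 'a::banach) \<Rightarrow> real" where
  "Lq_norm q f = (LINT t:{0..<1}|lborel. norm (f t) powr q) powr (1 / q)"

definition haar_block :: "(nat \<Rightarrow> int \<Rightarrow> 'a::banach) \<Rightarrow> nat \<Rightarrow> real \<Rightarrow> 'a" where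
  "haar_block x k t = (\<Sum>j\<in>{1..2 ^ (k - 1)}. haar k j t *\<^sub>R x k j)"

definition haar_sum :: "(nat \<Rightarrow> int \<Rightarrow> 'a::banach) \<Rightarrow> nat \<Rightarrow> real \<Rightarrow> 'a" where
  "haar_sum x n t = (\<Sum>k\<in>{1..n}. haar_block x k t)"

definition haar_type :: "'a::banach itself \<Rightarrow> real \<Rightarrow> bool" where
  "haar_type _ r \<longleftrightarrow> (\<exists>c\<ge>0. \<forall>(n::nat) (x :: nat \<Rightarrow> int \<Rightarrow> 'a). n \<ge> 1 \<longrightarrow>
      Lq_norm r (haar_sum x n) \<le> c * (\<Sum>k\<in>{1..n}. Lq_norm r (haar_block x k) powr r) powr (1 / r))"

definition weak_haar_type :: "'a::banach itself \<Rightarrow> real \<Rightarrow> bool" where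
  "weak_haar_type _ p \<longleftrightarrow> (\<exists>c\<ge>0. \<forall>(n::nat) (x :: nat \<Rightarrow> int \<Rightarrow> 'a). n \<ge> 1 \<longrightarrow>
      Lq_norm 2 (haar_sum x n) \<le>
        c * real n powr (1 / p - 1 / 2) * (\<Sum>k\<in>{1..n}. Lq_norm 2 (haar_block x k) powr 2) powr (1 / 2))"

end

theory Submission
  imports Defs
begin

text \<open>A Haar sum is a binary tree: a node carries the value of a martingale difference, which enters
  with sign + along the left branch and - along the right one. Fix q with r < q < p and stop a path
  just before the sum of the norm d powr q exceeds l powr q. This is predictable, because the norm
  of a Haar difference does not depend on its sign. Of the differences of norm about
  l / 2 ^ i at most 2 powr ((i + 1) q) survive on each path, so the weak type inequality for that many
  levels bounds their contribution in L_2; since q < p the bounds decay geometrically in i. With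
  Chebyshev's inequality this controls P(norm f > l) by the expectation of min (A / l powr q) 1, where
  A is the full sum of the norm d powr q. Summation over l = 2 powr m with weights 2 powr (m r) bounds
  the r-th moment of f by that of A powr (1 / q), because r < q, and A powr (r / q) is at
  most the sum of the norm d powr r.\<close>

section \<open>Trees of martingale differences\<close>

text \<open>Leaves may lie at different depths, so stopping a path amounts to replacing a subtree by
  a leaf.\<close>

datatype 'a dtree = Leaf | Node 'a "'a dtree" "'a dtree"

primrec paths :: "'a::real_normed_vector dtree \<Rightarrow> 'a list set" where
  "paths Leaf = {[]}"
| "paths (Node x L R) = (#) x ` paths L \<union> (#) (- x) ` paths R"

text \<open>The recursion replaces an average over \<open>paths T\<close>: distinct branches can
  yield the same list, and paths of different length have different probabilities.\<close>

primrec expect :: "'a::real_normed_vector dtree \<Rightarrow> ('a list \<Rightarrow> real) \<Rightarrow> real" where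
  "expect Leaf F = F []"
| "expect (Node x L R) F = (expect L (\<lambda>ds. F (x # ds)) + expect R (\<lambda>ds. F (- x # ds))) / 2"

definition power_sum :: "real \<Rightarrow> 'a::real_normed_vector list \<Rightarrow> real" where
  "power_sum q ds = (\<Sum>d\<leftarrow>ds. norm d powr q)"

lemma power_sum_simps [simp]:
  "power_sum q [] = 0" "power_sum q (d # ds) = norm d powr q + power_sum q ds"
  by (simp_all add: power_sum_def)

lemma power_sum_nonneg [simp]: "0 \<le> power_sum q ds"
  by (induction ds) auto

lemma finite_paths [simp]: "finite (paths T)"
  by (induction T) auto

lemma paths_nonempty [simp]: "paths T \<noteq> {}"
  by (induction T) auto

lemma expect_mono: "(\<And>ds. ds \<in> paths T \<Longrightarrow> F ds \<le> G ds) \<Longrightarrow> expect T F \<le> expect T G"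
proof (induction T arbitrary: F G)
  case (Node x L R)
  have "expect L (\<lambda>ds. F (x # ds)) \<le> expect L (\<lambda>ds. G (x # ds))"
    by (rule Node.IH) (simp add: Node.prems)
  moreover have "expect R (\<lambda>ds. F (- x # ds)) \<le> expect R (\<lambda>ds. G (- x # ds))"
    by (rule Node.IH) (simp add: Node.prems)
  ultimately show ?case by simp
qed simp

lemma expect_cong: "(\<And>ds. ds \<in> paths T \<Longrightarrow> F ds = G ds) \<Longrightarrow> expect T F = expect T G"
  by (intro antisym expect_mono) auto

lemma expect_add: "expect T (\<lambda>ds. F ds + G ds) = expect T F + expect T G"
  by (induction T arbitrary: F G) (auto simp: add_divide_distrib)

lemma expect_cmult: "expect T (\<lambda>ds. a * F ds) = a * expect T F"
  by (induction T arbitrary: F) (auto simp: algebra_simps)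

lemma expect_diff: "expect T (\<lambda>ds. F ds - G ds) = expect T F - expect T G"
  by (induction T arbitrary: F G) (auto simp: diff_divide_distrib add_divide_distrib)

lemma expect_sum: "expect T (\<lambda>ds. \<Sum>i\<in>I. F i ds) = (\<Sum>i\<in>I. expect T (F i))"
proof (induction T arbitrary: F)
  case (Node x L R)
  show ?case
    using Node.IH(1)[of "\<lambda>i ds. F i (x # ds)"] Node.IH(2)[of "\<lambda>i ds. F i (- x # ds)"]
    by (simp add: sum.distrib sum_divide_distrib add_divide_distrib)
qed simp

lemma expect_nonneg: "(\<And>ds. 0 \<le> F ds) \<Longrightarrow> 0 \<le> expect T F"
  by (induction T arbitrary: F) auto

text \<open>An odd map preserves the rule that the right branch carries the negative of the left
  one.\<close>

lemma paths_map_dtree: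
  assumes "\<And>x. g (- x) = - g x"
  shows "paths (map_dtree g T) = map g ` paths T"
  by (induction T) (auto simp: assms image_Un image_image)

lemma expect_map_dtree:
  assumes "\<And>x. g (- x) = - g x"
  shows "expect (map_dtree g T) F = expect T (\<lambda>ds. F (map g ds))"
  by (induction T arbitrary: F) (auto simp: assms)

section \<open>Predictable stopping\<close>

primrec stop_list :: "real \<Rightarrow> real \<Rightarrow> 'a::real_normed_vector list \<Rightarrow> 'a list" where
  "stop_list q a [] = []"
| "stop_list q a (d # ds) =
     (if norm d powr q \<le> a then d # stop_list q (a - norm d powr q) ds else [])"

primrec stop_tree :: "real \<Rightarrow> real \<Rightarrow> 'a::real_normed_vector dtree \<Rightarrow> 'a dtree" where
  "stop_tree q a Leaf = Leaf"
| "stop_tree q a (Node x L R) =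
     (if norm x powr q \<le> a
      then Node x (stop_tree q (a - norm x powr q) L) (stop_tree q (a - norm x powr q) R)
      else Leaf)"

lemma expect_const [simp]: "expect T (\<lambda>ds. a) = a"
  by (induction T) auto

lemma paths_stop_tree: "paths (stop_tree q a T) = stop_list q a ` paths T"
proof (induction T arbitrary: a)
  case (Node x L R)
  \<comment> \<open>At a node that is cut, every path is sent to the empty list; nonemptiness of
    \<open>paths L\<close> makes the image a singleton.\<close>
  have "(\<lambda>ds. []::'a list) ` (paths L \<union> paths R) = {[]}"
    using paths_nonempty[of L] by (intro image_constant_conv[THEN trans]) simp
  with Node show ?case
    by (simp add: image_Un image_image)
qed simp

lemma expect_stop_tree: "expect (stop_tree q a T) F = expect T (\<lambda>ds. F (stop_list q a ds))"
  by (induction T arbitrary: a F) auto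

lemma power_sum_stop_list_le:
  "0 \<le> a \<Longrightarrow> power_sum q (stop_list q a ds) \<le> min (power_sum q ds) a"
proof (induction ds arbitrary: a)
  case (Cons d ds)
  show ?case
    using Cons.IH[of "a - norm d powr q"] Cons.prems by (auto simp: add_nonneg_nonneg)
qed simp

lemma stop_list_eq_self: "power_sum q ds \<le> a \<Longrightarrow> stop_list q a ds = ds"
proof (induction ds arbitrary: a)
  case (Cons d ds)
  have "norm d powr q \<le> a"
    using Cons.prems power_sum_nonneg[of q ds] by (simp del: power_sum_nonneg)
  then show ?case using Cons by (simp add: algebra_simps)
qed simp

lemma norm_le_of_mem_stop_list:
  assumes "d \<in> set (stop_list q a ds)"
  shows "norm d powr q \<le> a"
  using assms
proof (induction ds arbitrary: a)
  case (Cons e ds)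
  show ?case
  proof (cases "norm e powr q \<le> a \<and> d \<noteq> e")
    case True
    then have "norm d powr q \<le> a - norm e powr q" using Cons by simp
    then show ?thesis by (smt (verit) powr_ge_zero)
  next
    case False
    then show ?thesis using Cons.prems by (auto split: if_splits)
  qed
qed simp

text \<open>Every surviving entry with property \<open>P\<close> costs at least \<open>b\<close>, so
  \<open>N + 1\<close> of them would exceed the budget \<open>a\<close>.\<close>

lemma length_filter_stop_list_le:
  assumes "a < (real N + 1) * b" "0 < b"
    and "\<And>d. d \<in> set (stop_list q a ds) \<Longrightarrow> P d \<Longrightarrow> b \<le> norm d powr q"
  shows "length (filter P (stop_list q a ds)) \<le> N"
  using assms
proof (induction ds arbitrary: a N)
  case (Cons d ds)
  show ?case
  proof (cases "norm d powr q \<le> a")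
    case le: True
    show ?thesis
    proof (cases "P d")
      case True
      then have "b \<le> norm d powr q" using Cons.prems(3)[of d] le by simp
      then have less: "a - norm d powr q < real N * b"
        using Cons.prems(1) by (simp add: algebra_simps)
      \<comment> \<open>For \<open>N = 0\<close> the remaining budget would be negative, contrary to
        \<open>le\<close>.\<close>
      then have "N \<noteq> 0" using le by (intro notI) simp
      then obtain M where M: "N = Suc M" by (cases N) auto
      have "length (filter P (stop_list q (a - norm d powr q) ds)) \<le> M"
        using less Cons.prems(2,3) le by (intro Cons.IH) (auto simp: M algebra_simps)
      then show ?thesis using True le M by simp
    next
      case False
      have "a - norm d powr q < (real N + 1) * b"
        using Cons.prems(1) by (smt (verit) powr_ge_zero)
      then have "length (filter P (stop_list q (a - norm d powr q) ds)) \<le> N"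
        using Cons.prems(2,3) le by (intro Cons.IH) auto
      then show ?thesis using False le by simp
    qed
  qed simp
qed simp

section \<open>Trees with few nonzero differences\<close>

definition zero_invariant :: "('a::real_normed_vector list \<Rightarrow> real) \<Rightarrow> bool" where
  "zero_invariant F \<longleftrightarrow> (\<forall>ds es. F (ds @ 0 # es) = F (ds @ es))"

lemma zero_invariant_Cons: "zero_invariant F \<Longrightarrow> zero_invariant (\<lambda>ds. F (d # ds))"
  unfolding zero_invariant_def
  by (intro allI, drule_tac x = "d # ds" in spec) simp

lemma zero_invariant_zero: "zero_invariant F \<Longrightarrow> F (0 # ds) = F ds"
  unfolding zero_invariant_def by (drule spec[of _ "[]"]) simp

text \<open>This is padding for leaves that are reached early: levels of zero differences bring them
  to the required depth at no cost.\<close>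

lemma zero_invariant_tree:
  assumes "zero_invariant F"
  shows "\<exists>T. (\<forall>ds\<in>paths T. length ds = N) \<and> expect T F = F []"
proof (induction N)
  case 0
  show ?case by (rule exI[of _ Leaf]) simp
next
  case (Suc N)
  then obtain T where T: "\<forall>ds\<in>paths T. length ds = N" "expect T F = F []" by blast
  then show ?case
    by (intro exI[of _ "Node 0 T T"]) (auto simp: zero_invariant_zero[OF assms])
qed

text \<open>At a node with zero difference both subtrees continue from the same value, so the
  better of the two may replace the node; this is what removes the zero differences.\<close>

lemma sparse_to_full:
  assumes "zero_invariant F"
    and "\<And>ds. ds \<in> paths T \<Longrightarrow> length (filter (\<lambda>d. d \<noteq> 0) ds) \<le> N"
  shows "\<exists>T'. (\<forall>ds\<in>paths T'. length ds = N) \<and> expect T F \<le> expect T' F"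
  using assms
proof (induction T arbitrary: F N)
  case Leaf
  then show ?case using zero_invariant_tree[of F N] by auto
next
  case (Node x L R)
  show ?case
  proof (cases "x = 0")
    case True
    have sparseL: "length (filter (\<lambda>d. d \<noteq> 0) ds) \<le> N" if "ds \<in> paths L" for ds
      using Node.prems(2)[of "0 # ds"] that True by auto
    have sparseR: "length (filter (\<lambda>d. d \<noteq> 0) ds) \<le> N" if "ds \<in> paths R" for ds
      using Node.prems(2)[of "0 # ds"] that True by auto
    obtain L' where L': "\<forall>ds\<in>paths L'. length ds = N" "expect L F \<le> expect L' F"
      using Node.IH(1)[OF Node.prems(1) sparseL] by blast
    obtain R' where R': "\<forall>ds\<in>paths R'. length ds = N" "expect R F \<le> expect R' F"
      using Node.IH(2)[OF Node.prems(1) sparseR] by blast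
    have eq: "expect (Node x L R) F = (expect L F + expect R F) / 2"
      by (simp add: True zero_invariant_zero[OF Node.prems(1)])
    show ?thesis
    proof (cases "expect L' F \<le> expect R' F")
      case True
      then show ?thesis using L' R' eq by (intro exI[of _ R']) auto
    next
      case False
      then show ?thesis using L' R' eq by (intro exI[of _ L']) auto
    qed
  next
    case False
    \<comment> \<open>A nonzero difference counts on every path through this node, so
      \<open>N\<close> is positive and each subtree is left with one fewer.\<close>
    obtain ds where "ds \<in> paths L" using paths_nonempty by blast
    then have "N \<noteq> 0" using Node.prems(2)[of "x # ds"] False by auto
    then obtain M where M: "N = Suc M" by (cases N) auto
    have sparseL: "length (filter (\<lambda>d. d \<noteq> 0) ds) \<le> M" if "ds \<in> paths L" for ds
      using Node.prems(2)[of "x # ds"] that False M by auto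
    have sparseR: "length (filter (\<lambda>d. d \<noteq> 0) ds) \<le> M" if "ds \<in> paths R" for ds
      using Node.prems(2)[of "- x # ds"] that False M by auto
    obtain L' where L': "\<forall>ds\<in>paths L'. length ds = M"
        "expect L (\<lambda>ds. F (x # ds)) \<le> expect L' (\<lambda>ds. F (x # ds))"
      using Node.IH(1)[OF zero_invariant_Cons[OF Node.prems(1)] sparseL] by blast
    obtain R' where R': "\<forall>ds\<in>paths R'. length ds = M"
        "expect R (\<lambda>ds. F (- x # ds)) \<le> expect R' (\<lambda>ds. F (- x # ds))"
      using Node.IH(2)[OF zero_invariant_Cons[OF Node.prems(1)] sparseR] by blast
    show ?thesis
      using L' R' M by (intro exI[of _ "Node x L' R'"]) auto
  qed
qed

text \<open>What matters in the weak type inequality is thus the number of nonzero differences on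
  each path, not the number of levels.\<close>

lemma weak_type_sparse:
  fixes T :: "'a::real_normed_vector dtree"
  assumes weak: "\<And>T :: 'a dtree. (\<And>ds. ds \<in> paths T \<Longrightarrow> length ds = N) \<Longrightarrow>
      expect T (\<lambda>ds. (norm (sum_list ds))\<^sup>2) \<le> K * expect T (power_sum 2)"
    and sparse: "\<And>ds. ds \<in> paths T \<Longrightarrow> length (filter (\<lambda>d. d \<noteq> 0) ds) \<le> N"
  shows "expect T (\<lambda>ds. (norm (sum_list ds))\<^sup>2) \<le> K * expect T (power_sum 2)"
proof -
  \<comment> \<open>Both sides go into one functional, because \<open>sparse_to_full\<close>
    controls only the expectation of that functional and neither side separately.\<close>
  define F :: "'a list \<Rightarrow> real" where "F ds = (norm (sum_list ds))\<^sup>2 - K * power_sum 2 ds" for ds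
  have F: "expect T F = expect T (\<lambda>ds. (norm (sum_list ds))\<^sup>2) - K * expect T (power_sum 2)"
    for T :: "'a dtree"
    by (simp add: F_def[abs_def] expect_diff expect_cmult)
  have "zero_invariant F"
    by (simp add: zero_invariant_def F_def power_sum_def)
  from sparse_to_full[OF this sparse] obtain T' where
    T': "\<And>ds. ds \<in> paths T' \<Longrightarrow> length ds = N" "expect T F \<le> expect T' F" by metis
  show ?thesis using weak[of T', OF T'(1)] T'(2) by (simp add: F)
qed

section \<open>Second moments of stopped trees\<close>

text \<open>This is weak Haar type squared: \<open>K\<close> stands for the square of the constant,
  and the exponent of \<open>N\<close> is twice \<open>1 / p - 1 / 2\<close>.\<close>

definition weak_tree_type :: "'a::real_normed_vector itself \<Rightarrow> real \<Rightarrow> real \<Rightarrow> bool" where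
  "weak_tree_type _ K p \<longleftrightarrow> (\<forall>N (T :: 'a dtree). 1 \<le> N \<longrightarrow> (\<forall>ds\<in>paths T. length ds = N) \<longrightarrow>
     expect T (\<lambda>ds. (norm (sum_list ds))\<^sup>2) \<le> K * real N powr (2 / p - 1) * expect T (power_sum 2))"

text \<open>Differences of other sizes become 0 instead of being removed, so that the map is odd and
  acts on trees; the zeros are harmless by \<open>weak_type_sparse\<close>.\<close>

definition size_level :: "real \<Rightarrow> nat \<Rightarrow> 'a::real_normed_vector \<Rightarrow> 'a" where
  "size_level l i d = (if l / 2 ^ Suc i < norm d \<and> norm d \<le> l / 2 ^ i then d else 0)"

lemma size_level_minus [simp]: "size_level l i (- d) = - size_level l i d"
  by (simp add: size_level_def)

lemma sum_size_level:
  assumes "0 \<le> l"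
  shows "(\<Sum>i<I. size_level l i d) = (if l / 2 ^ I < norm d \<and> norm d \<le> l then d else 0)"
proof (induction I)
  case (Suc I)
  have "l / 2 ^ Suc I \<le> l / 2 ^ I" "l / 2 ^ I \<le> l"
    using assms mult_left_mono[of 1 "2 ^ I" l] by (auto simp: field_simps)
  then show ?case unfolding sum.lessThan_Suc Suc by (auto simp: size_level_def)
qed auto

text \<open>Write the square of the norm as \<open>norm d powr (2 - q) * norm d powr q\<close>; on
  level \<open>i\<close> the first factor is at most \<open>(l / 2 ^ i) powr (2 - q)\<close>, which
  is the source of the decay in \<open>i\<close>.\<close>

lemma power_sum_size_level_le:
  assumes "0 < l" "q < 2"
  shows "power_sum 2 (map (size_level l i) ds) \<le> (l / 2 ^ i) powr (2 - q) * power_sum q ds"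
proof (induction ds)
  case (Cons d ds)
  have "norm (size_level l i d) powr 2 \<le> (l / 2 ^ i) powr (2 - q) * norm d powr q"
  proof (cases "l / 2 ^ Suc i < norm d \<and> norm d \<le> l / 2 ^ i")
    case True
    have "norm d powr 2 = norm d powr (2 - q) * norm d powr q"
      by (simp add: powr_add[symmetric])
    also have "\<dots> \<le> (l / 2 ^ i) powr (2 - q) * norm d powr q"
      using True assms by (intro mult_right_mono powr_mono2) auto
    finally show ?thesis using True by (simp add: size_level_def)
  qed (auto simp: size_level_def)
  with Cons show ?case by (simp add: distrib_left)
qed simp

text \<open>Two effects compete: the number of differences contributes growth of order
  \<open>2 powr (i * q * (2 / p - 1))\<close>, their size contributes
  \<open>2 powr (- i * (2 - q))\<close>. The exponents add up to \<open>2 * i * (q / p - 1)\<close>,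
  which is negative for \<open>q < p\<close> and \<open>i > 0\<close>.\<close>

lemma level_second_moment:
  fixes T :: "'a::real_normed_vector dtree"
  assumes weak: "weak_tree_type TYPE('a) K p" and "0 \<le> K"
    and "0 < q" "q < 2" "0 < p" "p < 2" "0 < l"
  shows "expect T (\<lambda>ds. (norm (sum_list (map (size_level l i) (stop_list q (l powr q) ds))))\<^sup>2)
    \<le> K * 2 powr (q * (2 / p - 1)) * (2 powr (q / p - 1)) ^ (2 * i)
        * (l powr (2 - q) * expect T (\<lambda>ds. power_sum q (stop_list q (l powr q) ds)))"
    (is "_ \<le> _ * (_ * ?E)")
proof -
  \<comment> \<open>Each difference of level \<open>i\<close> costs at least the fraction
    \<open>1 / 2 powr ((i + 1) * q)\<close> of the budget \<open>l powr q\<close>, so no more than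
    this many fit on a stopped path.\<close>
  define N where "N = nat \<lfloor>2 powr (real (Suc i) * q)\<rfloor>"
  define S where "S = map_dtree (size_level l i) (stop_tree q (l powr q) T)"
  have "1 \<le> 2 powr (real (Suc i) * q)"
    using assms by (intro ge_one_powr_ge_zero) auto
  then have N: "1 \<le> N" "real N \<le> 2 powr (real (Suc i) * q)" "2 powr (real (Suc i) * q) < real N + 1"
    unfolding N_def by linarith+
  have pow: "(l / 2 ^ Suc i) powr q = l powr q / 2 powr (real (Suc i) * q)"
    using assms by (simp only: powr_divide powr_realpow[symmetric] powr_powr zero_less_numeral
        less_imp_le zero_le_power zero_le_numeral powr_ge_zero)
  have "l powr q < (real N + 1) * (l / 2 ^ Suc i) powr q"
  proof -
    have "l powr q * 2 powr (real (Suc i) * q) < l powr q * (real N + 1)"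
      using N(3) assms by (intro mult_strict_left_mono) auto
    then show ?thesis unfolding pow by (simp add: field_simps)
  qed
  then have sparse: "length (filter (\<lambda>d. d \<noteq> 0) ds) \<le> N" if path: "ds \<in> paths S" for ds
  proof -
    obtain es where ds: "ds = map (size_level l i) (stop_list q (l powr q) es)"
      using path by (auto simp: S_def paths_map_dtree paths_stop_tree)
    have "length (filter (\<lambda>d. size_level l i d \<noteq> 0) (stop_list q (l powr q) es)) \<le> N"
      using \<open>l powr q < _\<close>
    proof (rule length_filter_stop_list_le)
      show "(l / 2 ^ Suc i) powr q \<le> norm d powr q" if "size_level l i d \<noteq> 0" for d
        using that assms by (intro powr_mono2) (auto simp: size_level_def split: if_splits)
    qed (use assms in auto)
    then show ?thesis by (simp add: ds filter_map o_def)
  qed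
  have "expect S (\<lambda>ds. (norm (sum_list ds))\<^sup>2) \<le> (K * real N powr (2 / p - 1)) * expect S (power_sum 2)"
  proof (rule weak_type_sparse[OF _ sparse])
    fix T :: "'a dtree"
    assume "\<And>ds. ds \<in> paths T \<Longrightarrow> length ds = N"
    then show "expect T (\<lambda>ds. (norm (sum_list ds))\<^sup>2) \<le> (K * real N powr (2 / p - 1)) * expect T (power_sum 2)"
      using weak N(1) unfolding weak_tree_type_def by blast
  qed
  also have "\<dots> \<le> (K * (2 powr (real (Suc i) * q)) powr (2 / p - 1)) * ((l / 2 ^ i) powr (2 - q) * ?E)"
  proof (intro mult_mono)
    show "real N powr (2 / p - 1) \<le> (2 powr (real (Suc i) * q)) powr (2 / p - 1)"
      using N assms by (intro powr_mono2) auto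
    show "expect S (power_sum 2) \<le> (l / 2 ^ i) powr (2 - q) * ?E"
      unfolding S_def expect_map_dtree[of "size_level l i", OF size_level_minus] expect_stop_tree expect_cmult[symmetric]
      using assms by (intro expect_mono power_sum_size_level_le)
    show "0 \<le> expect S (power_sum 2)"
      by (rule expect_nonneg) simp
  qed (use assms in auto)
  also have "\<dots> = K * ((2 powr (real (Suc i) * q)) powr (2 / p - 1) * (1 / 2 ^ i) powr (2 - q)) * (l powr (2 - q) * ?E)"
    using assms by (simp add: powr_divide)
  also have "(2 powr (real (Suc i) * q)) powr (2 / p - 1) * (1 / 2 ^ i) powr (2 - q) =
      2 powr (real (Suc i) * q * (2 / p - 1) - real i * (2 - q))"
  proof -
    have "1 / 2 ^ i = (2::real) powr (- real i)"
      by (simp add: powr_minus powr_realpow divide_inverse)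
    then show ?thesis by (simp only: powr_powr powr_add[symmetric]) simp
  qed
  also have "real (Suc i) * q * (2 / p - 1) - real i * (2 - q) =
      q * (2 / p - 1) + (q / p - 1) * real (2 * i)"
    using assms by (simp add: field_simps)
  also have "2 powr (q * (2 / p - 1) + (q / p - 1) * real (2 * i)) =
      2 powr (q * (2 / p - 1)) * (2 powr (q / p - 1)) ^ (2 * i)"
    unfolding powr_add powr_powr[symmetric] by (subst powr_realpow) auto
  finally show ?thesis
    by (simp add: S_def expect_map_dtree expect_stop_tree mult.assoc)
qed

lemma sum_list_sum_swap:
  fixes g :: "'b \<Rightarrow> 'c \<Rightarrow> 'a::comm_monoid_add"
  shows "(\<Sum>d\<leftarrow>ds. \<Sum>i\<in>I. g i d) = (\<Sum>i\<in>I. \<Sum>d\<leftarrow>ds. g i d)"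
  by (induction ds) (simp_all add: sum.distrib)

text \<open>The levels are summed by a weighted Cauchy-Schwarz inequality. It produces two geometric
  series with ratio \<open>2 powr (q / p - 1)\<close>, hence the squared denominator.\<close>

lemma stopped_second_moment:
  fixes T :: "'a::real_normed_vector dtree"
  assumes weak: "weak_tree_type TYPE('a) K p" and "0 \<le> K"
    and "0 < q" "q < p" "p < 2" "0 < l"
  shows "expect T (\<lambda>ds. (norm (sum_list (stop_list q (l powr q) ds)))\<^sup>2)
    \<le> K * 2 powr (q * (2 / p - 1)) / (1 - 2 powr (q / p - 1))\<^sup>2
        * (l powr (2 - q) * expect T (\<lambda>ds. power_sum q (stop_list q (l powr q) ds)))"
proof -
  define \<rho> :: real where "\<rho> = 2 powr (q / p - 1)"
  define E where "E = K * 2 powr (q * (2 / p - 1)) *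
    (l powr (2 - q) * expect T (\<lambda>ds. power_sum q (stop_list q (l powr q) ds)))"
  define Y where "Y i ds = sum_list (map (size_level l i) (stop_list q (l powr q) ds))"
    for i and ds :: "'a list"
  have \<rho>: "0 < \<rho>" "\<rho> < 1"
    using assms powr_less_mono[of "q / p - 1" 0 2] by (auto simp: \<rho>_def)
  have E: "0 \<le> E"
    unfolding E_def using assms by (intro mult_nonneg_nonneg expect_nonneg) auto
  \<comment> \<open>A finite tree has a positive lower bound for its nonzero norms, so finitely many
    levels exhaust the stopped sum.\<close>
  define D where "D = norm ` (\<Union>ds\<in>paths T. set ds) - {0}"
  have "finite D" "\<And>d. d \<in> D \<Longrightarrow> 0 < d" by (auto simp: D_def)
  then have "\<exists>\<epsilon>>0. \<forall>d\<in>D. \<epsilon> < d"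
  proof (induction D)
    case (insert d D)
    then obtain \<epsilon> where "\<epsilon> > 0" "\<forall>d\<in>D. \<epsilon> < d" by auto
    then show ?case using insert.prems[of d] by (intro exI[of _ "min \<epsilon> (d / 2)"]) auto
  qed (auto intro: exI[of _ 1])
  then obtain \<epsilon> where \<epsilon>: "\<epsilon> > 0" "\<And>d. d \<in> D \<Longrightarrow> \<epsilon> < d" by blast
  obtain I where "(1 / 2) ^ I < \<epsilon> / l"
    using real_arch_pow_inv[of "\<epsilon> / l" "1 / 2"] \<epsilon> assms by auto
  then have I: "l / 2 ^ I < \<epsilon>"
    using assms by (simp add: field_simps)
  have geo: "(\<Sum>i<I. \<rho> ^ i) \<le> 1 / (1 - \<rho>)"
    using \<rho> by (simp add: sum_gp_strict field_simps)
  have decomp: "sum_list (stop_list q (l powr q) ds) = (\<Sum>i<I. Y i ds)" if "ds \<in> paths T" for ds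
  proof -
    have "(\<Sum>i<I. size_level l i d) = d" if d: "d \<in> set (stop_list q (l powr q) ds)" for d
    proof (cases "d = 0")
      case False
      have "set (stop_list q a ds) \<subseteq> set ds" for a
        by (induction ds arbitrary: a) auto
      then have "norm d \<in> D" using d False \<open>ds \<in> paths T\<close> by (auto simp: D_def)
      then have "l / 2 ^ I < norm d" using \<epsilon> I by fastforce
      moreover have "norm d \<le> l"
        using norm_le_of_mem_stop_list[OF d] assms powr_less_mono2[of q l "norm d"] by force
      ultimately show ?thesis using assms by (simp add: sum_size_level)
    qed (simp add: sum_size_level[of l] assms size_level_def)
    then have "sum_list (stop_list q (l powr q) ds) =
        (\<Sum>d\<leftarrow>stop_list q (l powr q) ds. \<Sum>i<I. size_level l i d)"
      by (simp cong: map_cong)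
    also have "\<dots> = (\<Sum>i<I. Y i ds)"
      unfolding Y_def by (rule sum_list_sum_swap)
    finally show ?thesis .
  qed
  \<comment> \<open>The weights \<open>\<rho> ^ i\<close> give the first geometric series; dividing
    the level bound \<open>E * \<rho> ^ (2 * i)\<close> by \<open>\<rho> ^ i\<close> leaves the
    second.\<close>
  have CS: "(norm (\<Sum>i<I. Y i ds))\<^sup>2 \<le> (\<Sum>i<I. (norm (Y i ds))\<^sup>2 / \<rho> ^ i) / (1 - \<rho>)" for ds
  proof -
    have "(norm (\<Sum>i<I. Y i ds))\<^sup>2 \<le> (\<Sum>i<I. sqrt (\<rho> ^ i) * (norm (Y i ds) / sqrt (\<rho> ^ i)))\<^sup>2"
      using \<rho> norm_sum[of "\<lambda>i. Y i ds" "{..<I}"] by (intro power_mono) auto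
    also have "\<dots> \<le> (\<Sum>i<I. (sqrt (\<rho> ^ i))\<^sup>2) * (\<Sum>i<I. (norm (Y i ds) / sqrt (\<rho> ^ i))\<^sup>2)"
      by (rule Cauchy_Schwarz_ineq_sum)
    also have "\<dots> = (\<Sum>i<I. \<rho> ^ i) * (\<Sum>i<I. (norm (Y i ds))\<^sup>2 / \<rho> ^ i)"
      using \<rho> by (simp add: power_divide)
    also have "\<dots> \<le> 1 / (1 - \<rho>) * (\<Sum>i<I. (norm (Y i ds))\<^sup>2 / \<rho> ^ i)"
      using \<rho> geo by (intro mult_right_mono sum_nonneg) auto
    finally show ?thesis by simp
  qed
  have "expect T (\<lambda>ds. (norm (sum_list (stop_list q (l powr q) ds)))\<^sup>2) \<le>
      expect T (\<lambda>ds. 1 / (1 - \<rho>) * (\<Sum>i<I. 1 / \<rho> ^ i * (norm (Y i ds))\<^sup>2))"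
    using CS by (intro expect_mono) (simp add: decomp)
  also have "\<dots> = 1 / (1 - \<rho>) * (\<Sum>i<I. 1 / \<rho> ^ i * expect T (\<lambda>ds. (norm (Y i ds))\<^sup>2))"
    by (simp only: expect_cmult expect_sum)
  also have "\<dots> \<le> 1 / (1 - \<rho>) * (\<Sum>i<I. 1 / \<rho> ^ i * (E * \<rho> ^ (2 * i)))"
  proof (intro mult_left_mono sum_mono)
    fix i
    show "expect T (\<lambda>ds. (norm (Y i ds))\<^sup>2) \<le> E * \<rho> ^ (2 * i)"
      using level_second_moment[OF weak, of q l T i] assms
      by (simp add: Y_def E_def \<rho>_def mult_ac)
  qed (use \<rho> in auto)
  also have "\<dots> = 1 / (1 - \<rho>) * (E * (\<Sum>i<I. \<rho> ^ i))"
    using \<rho> by (simp add: sum_distrib_left power_mult power2_eq_square power_mult_distrib mult_ac)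
  also have "\<dots> \<le> 1 / (1 - \<rho>) * (E * (1 / (1 - \<rho>)))"
    using \<rho> E geo by (intro mult_left_mono) auto
  also have "\<dots> = E / (1 - \<rho>)\<^sup>2"
    by (simp add: power2_eq_square)
  finally show ?thesis by (simp add: E_def \<rho>_def)
qed

section \<open>From tails to moments\<close>

text \<open>Division by \<open>a + b\<close> moves both terms into the unit interval, where
  \<open>y \<le> y powr s\<close>.\<close>

lemma powr_add_le_add_powr:
  fixes a b s :: real
  assumes "0 \<le> a" "0 \<le> b" "0 < s" "s \<le> 1"
  shows "(a + b) powr s \<le> a powr s + b powr s"
proof (cases "a + b = 0")
  case False
  then have pos: "0 < a + b" using assms by simp
  have frac: "y \<le> y powr s" if "0 \<le> y" "y \<le> 1" for y :: real
    using that assms powr_mono'[of s 1 y] by (cases "y = 0") auto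
  have "1 = a / (a + b) + b / (a + b)"
    using pos by (simp add: add_divide_distrib[symmetric])
  also have "\<dots> \<le> (a / (a + b)) powr s + (b / (a + b)) powr s"
    using assms pos by (intro add_mono frac) auto
  also have "\<dots> = (a powr s + b powr s) / (a + b) powr s"
    using assms pos by (simp add: powr_divide add_divide_distrib)
  finally show ?thesis using pos by (simp add: field_simps)
qed (use assms in auto)

text \<open>This is the inclusion of l_r in l_q; it removes the auxiliary exponent \<open>q\<close>
  from the final bound.\<close>

lemma power_sum_powr_le:
  assumes "0 < r" "r \<le> q"
  shows "power_sum q ds powr (r / q) \<le> power_sum r ds"
proof (induction ds)
  case (Cons d ds)
  have "(norm d powr q + power_sum q ds) powr (r / q) \<le>
      (norm d powr q) powr (r / q) + power_sum q ds powr (r / q)"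
    using assms by (intro powr_add_le_add_powr) auto
  also have "(norm d powr q) powr (r / q) = norm d powr r"
    using assms by (simp add: powr_powr)
  finally show ?case using Cons.IH by simp
qed simp

text \<open>The terms belong to a geometric series that descends from the one at
  \<open>Max S\<close>, which is at most \<open>b\<close>.\<close>

lemma sum_powr_two_le:
  fixes S :: "int set"
  assumes "finite S" "0 < s" "0 \<le> b" and le: "\<And>m. m \<in> S \<Longrightarrow> 2 powr (real_of_int m * s) \<le> b"
  shows "(\<Sum>m\<in>S. 2 powr (real_of_int m * s)) \<le> b / (1 - 2 powr (- s))"
proof -
  have \<rho>: "2 powr (- s) < (1::real)" using assms powr_less_mono[of "- s" 0 2] by simp
  show ?thesis
  proof (cases "S = {}")
    case False
    define M where "M = Max S"
    have M: "M \<in> S" "\<And>m. m \<in> S \<Longrightarrow> m \<le> M"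
      using False assms by (auto simp: M_def)
    have "(\<Sum>m\<in>S. 2 powr (real_of_int m * s)) =
        2 powr (real_of_int M * s) * (\<Sum>m\<in>S. (2 powr (- s)) ^ nat (M - m))"
      unfolding sum_distrib_left
    proof (intro sum.cong refl)
      fix m assume "m \<in> S"
      then have "real (nat (M - m)) = real_of_int M - real_of_int m" using M by simp
      then have "(2 powr (- s)) ^ nat (M - m) = 2 powr (- s * (real_of_int M - real_of_int m))"
        by (metis powr_gt_zero powr_powr powr_realpow zero_neq_numeral)
      then show "2 powr (real_of_int m * s) = 2 powr (real_of_int M * s) * (2 powr (- s)) ^ nat (M - m)"
        by (simp add: powr_add[symmetric] algebra_simps)
    qed
    also have "(\<Sum>m\<in>S. (2 powr (- s)) ^ nat (M - m)) = (\<Sum>i\<in>(\<lambda>m. nat (M - m)) ` S. (2 powr (- s)) ^ i)"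
    proof (rule sum.reindex_cong[symmetric, OF _ refl refl])
      show "inj_on (\<lambda>m. nat (M - m)) S"
        using M(2) by (intro inj_onI) (smt (verit) nat_eq_iff2)
    qed
    also have "\<dots> \<le> (\<Sum>i. (2 powr (- s)) ^ i)"
      using \<rho> assms by (intro sum_le_suminf summable_geometric) auto
    also have "\<dots> = 1 / (1 - 2 powr (- s))"
      using \<rho> by (intro suminf_geometric) auto
    also have "2 powr (real_of_int M * s) * (1 / (1 - 2 powr (- s))) \<le> b * (1 / (1 - 2 powr (- s)))"
      using le[OF M(1)] \<rho> by (intro mult_right_mono) auto
    finally show ?thesis by simp
  qed (use \<rho> assms in auto)
qed

text \<open>The sum is split where \<open>2 powr m\<close> passes \<open>A powr (1 / q)\<close>.
  Below, the minimum is estimated by 1 and the series converges because \<open>0 < r\<close>; above,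
  it is estimated by the quotient and \<open>r < q\<close> gives convergence.\<close>

lemma dyadic_layers_upper:
  fixes S :: "int set"
  assumes S: "finite S" and "0 < r" "r < q" "0 \<le> A"
  shows "(\<Sum>m\<in>S. 2 powr (real_of_int m * r) * min (A / (2 powr real_of_int m) powr q) 1)
    \<le> (1 / (1 - 2 powr (- r)) + 1 / (1 - 2 powr (- (q - r)))) * A powr (r / q)"
proof (cases "A = 0")
  case False
  then have A: "0 < A" using assms by simp
  define S1 where "S1 = {m\<in>S. 2 powr real_of_int m \<le> A powr (1 / q)}"
  define S2 where "S2 = S - S1"
  let ?t = "\<lambda>m. 2 powr (real_of_int m * r) * min (A / (2 powr real_of_int m) powr q) 1"
  have split: "sum ?t S = sum ?t S1 + sum ?t S2"
    using S by (subst sum.union_disjoint[symmetric]) (auto simp: S1_def S2_def intro: sum.cong)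
  have "sum ?t S1 \<le> (\<Sum>m\<in>S1. 2 powr (real_of_int m * r))"
    by (intro sum_mono) (simp add: mult_left_le)
  also have "\<dots> \<le> A powr (r / q) / (1 - 2 powr (- r))"
  proof (rule sum_powr_two_le)
    fix m assume "m \<in> S1"
    then have "(2 powr real_of_int m) powr r \<le> (A powr (1 / q)) powr r"
      using assms by (intro powr_mono2) (auto simp: S1_def)
    then show "2 powr (real_of_int m * r) \<le> A powr (r / q)" by (simp add: powr_powr)
  qed (use S assms in \<open>auto simp: S1_def\<close>)
  finally have 1: "sum ?t S1 \<le> A powr (r / q) / (1 - 2 powr (- r))" .
  have "sum ?t S2 \<le> (\<Sum>m\<in>S2. A * 2 powr (real_of_int (- m) * (q - r)))"
  proof (intro sum_mono)
    fix m
    have "?t m \<le> 2 powr (real_of_int m * r) * (A / (2 powr real_of_int m) powr q)"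
      by (intro mult_left_mono) auto
    also have "\<dots> = A * 2 powr (real_of_int (- m) * (q - r))"
      by (simp add: powr_powr powr_diff[symmetric] algebra_simps)
        (simp add: powr_diff)
    finally show "?t m \<le> A * 2 powr (real_of_int (- m) * (q - r))" .
  qed
  \<comment> \<open>These terms decrease in \<open>m\<close>, so the index is reflected to fit
    \<open>sum_powr_two_le\<close>.\<close>
  also have "\<dots> = A * (\<Sum>m\<in>uminus ` S2. 2 powr (real_of_int m * (q - r)))"
    by (simp add: sum_distrib_left sum.reindex)
  also have "\<dots> \<le> A * (A powr (- (q - r) / q) / (1 - 2 powr (- (q - r))))"
  proof (intro mult_left_mono sum_powr_two_le)
    fix m assume "m \<in> uminus ` S2"
    then have "A powr (1 / q) \<le> 2 powr real_of_int (- m)"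
      by (auto simp: S1_def S2_def)
    then have "(2 powr real_of_int (- m)) powr (- (q - r)) \<le> (A powr (1 / q)) powr (- (q - r))"
      using assms A by (intro powr_mono2') auto
    then show "2 powr (real_of_int m * (q - r)) \<le> A powr (- (q - r) / q)"
      by (simp add: powr_powr algebra_simps)
  qed (use S assms in \<open>auto simp: S2_def\<close>)
  also have "\<dots> = A powr (1 + - (q - r) / q) / (1 - 2 powr (- (q - r)))"
    using A by (simp add: powr_add)
  also have "1 + - (q - r) / q = r / q"
    using assms by (simp add: field_simps)
  finally have 2: "sum ?t S2 \<le> A powr (r / q) / (1 - 2 powr (- (q - r)))" .
  have "sum ?t S \<le> A powr (r / q) / (1 - 2 powr (- r)) + A powr (r / q) / (1 - 2 powr (- (q - r)))"
    unfolding split by (rule add_mono[OF 1 2])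
  then show ?thesis by (simp add: distrib_right)
qed auto

text \<open>A discrete layer cake formula: the single scale with
  \<open>2 powr m < u \<le> 2 powr (m + 1)\<close> already recovers \<open>u powr r\<close> up to
  \<open>2 powr r\<close>. Finitely many values of \<open>u\<close> need finitely many scales, which
  avoids infinite sums.\<close>

lemma dyadic_layers_lower:
  assumes "finite U" "0 < r" "\<And>u. u \<in> U \<Longrightarrow> 0 \<le> u"
  shows "\<exists>S::int set. finite S \<and> (\<forall>u\<in>U.
    u powr r \<le> 2 powr r * (\<Sum>m\<in>S. 2 powr (real_of_int m * r) * of_bool (2 powr real_of_int m < u)))"
proof (intro exI conjI ballI)
  \<comment> \<open>For positive \<open>u\<close> this is the largest integer \<open>m\<close> with
    \<open>2 powr m\<close> strictly below \<open>u\<close>.\<close>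
  let ?m = "\<lambda>u::real. \<lceil>log 2 u\<rceil> - 1"
  show fin: "finite (?m ` U)" using assms by simp
  fix u assume u: "u \<in> U"
  let ?t = "\<lambda>m. 2 powr (real_of_int m * r) * of_bool (2 powr real_of_int m < u)"
  show "u powr r \<le> 2 powr r * sum ?t (?m ` U)"
  proof (cases "u = 0")
    case True
    then show ?thesis by (auto intro!: mult_nonneg_nonneg sum_nonneg)
  next
    case False
    then have pos: "0 < u" using assms(3)[OF u] by simp
    have "real_of_int (?m u) < log 2 u" by linarith
    then have lt: "2 powr real_of_int (?m u) < u"
      using pos by (subst (asm) less_log_iff) auto
    have "log 2 u \<le> real_of_int (?m u) + 1" by linarith
    then have le: "u \<le> 2 powr (real_of_int (?m u) + 1)"
      using pos by (subst (asm) log_le_iff) auto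
    have "u powr r \<le> (2 powr (real_of_int (?m u) + 1)) powr r"
      using le pos assms by (intro powr_mono2) auto
    also have "\<dots> = 2 powr r * ?t (?m u)"
      unfolding of_bool_eq_iff using lt by (simp add: powr_powr powr_add[symmetric] algebra_simps)
    also have "?t (?m u) \<le> sum ?t (?m ` U)"
      using u fin by (intro member_le_sum) auto
    finally show ?thesis by simp
  qed
qed

text \<open>If the power sum stays within the budget, stopping changes nothing and Chebyshev's
  inequality applies to the stopped sum; otherwise the minimum equals 1 and covers the event. The
  stopped power sum is itself at most the minimum of the full one and \<open>l powr q\<close>, so
  both contributions have the same form.\<close>

lemma tail_bound:
  fixes T :: "'a::real_normed_vector dtree"
  assumes weak: "weak_tree_type TYPE('a) K p" and "0 \<le> K"
    and "0 < q" "q < p" "p < 2" "0 < l"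
  shows "expect T (\<lambda>ds. of_bool (l < norm (sum_list ds))) \<le>
    (1 + K * 2 powr (q * (2 / p - 1)) / (1 - 2 powr (q / p - 1))\<^sup>2) *
      expect T (\<lambda>ds. min (power_sum q ds / l powr q) 1)"
proof -
  let ?st = "stop_list q (l powr q)"
  define D where "D = K * 2 powr (q * (2 / p - 1)) / (1 - 2 powr (q / p - 1))\<^sup>2"
  define Q where "Q = expect T (\<lambda>ds. min (power_sum q ds / l powr q) 1)"
  have D: "0 \<le> D" using assms by (simp add: D_def)
  have "of_bool (l < norm (sum_list ds)) \<le>
      min (power_sum q ds / l powr q) 1 + (1 / l\<^sup>2) * (norm (sum_list (?st ds)))\<^sup>2" for ds :: "'a list"
  proof (cases "power_sum q ds \<le> l powr q")
    case True
    show ?thesis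
    proof (cases "l < norm (sum_list ds)")
      case less: True
      have "l\<^sup>2 \<le> (norm (sum_list ds))\<^sup>2"
        using less assms by (intro power_mono) auto
      then have "1 \<le> (1 / l\<^sup>2) * (norm (sum_list (?st ds)))\<^sup>2"
        using assms by (simp add: stop_list_eq_self[OF True])
      then show ?thesis using less by (simp add: add_increasing)
    qed simp
  next
    case False
    then have "min (power_sum q ds / l powr q) 1 = 1" using assms by (simp add: min_def)
    then show ?thesis by simp
  qed
  then have "expect T (\<lambda>ds. of_bool (l < norm (sum_list ds))) \<le>
      Q + (1 / l\<^sup>2) * expect T (\<lambda>ds. (norm (sum_list (?st ds)))\<^sup>2)"
    unfolding Q_def expect_cmult[symmetric] expect_add[symmetric] by (intro expect_mono)
  also have "\<dots> \<le> Q + (1 / l\<^sup>2) * (D * (l powr (2 - q) * expect T (\<lambda>ds. power_sum q (?st ds))))"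
    unfolding D_def using stopped_second_moment[OF assms, of T]
    by (intro add_left_mono mult_left_mono) auto
  also have "\<dots> = Q + D * ((l powr (2 - q) / l powr 2) * expect T (\<lambda>ds. power_sum q (?st ds)))"
    using assms by simp
  also have "l powr (2 - q) / l powr 2 = 1 / l powr q"
    using assms by (simp add: powr_diff)
  finally have le: "expect T (\<lambda>ds. of_bool (l < norm (sum_list ds))) \<le>
      Q + D * (1 / l powr q * expect T (\<lambda>ds. power_sum q (?st ds)))" .
  have "1 / l powr q * expect T (\<lambda>ds. power_sum q (?st ds)) \<le> Q"
    unfolding Q_def expect_cmult[symmetric]
  proof (rule expect_mono)
    fix ds :: "'a list"
    show "1 / l powr q * power_sum q (?st ds) \<le> min (power_sum q ds / l powr q) 1"
      using power_sum_stop_list_le[of "l powr q" q ds] assms by (simp add: field_simps)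
  qed
  then have "D * (1 / l powr q * expect T (\<lambda>ds. power_sum q (?st ds))) \<le> D * Q"
    using D by (rule mult_left_mono)
  with le have "expect T (\<lambda>ds. of_bool (l < norm (sum_list ds))) \<le> (1 + D) * Q"
    by (simp add: distrib_right)
  then show ?thesis by (simp only: D_def Q_def)
qed

text \<open>The set of scales depends on \<open>T\<close>, but the constant does not, since
  \<open>dyadic_layers_upper\<close> is uniform in \<open>S\<close>.\<close>

lemma moment_bound:
  fixes p q r K :: real
  assumes weak: "weak_tree_type TYPE('a::real_normed_vector) K p" and K: "0 \<le> K"
    and "0 < r" "r < q" "q < p" "p < 2"
  shows "\<exists>C\<ge>0. \<forall>T :: 'a dtree.
    expect T (\<lambda>ds. norm (sum_list ds) powr r) \<le> C * expect T (power_sum r)"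
proof -
  define D where "D = 1 + K * 2 powr (q * (2 / p - 1)) / (1 - 2 powr (q / p - 1))\<^sup>2"
  define B where "B = 1 / (1 - 2 powr (- r)) + 1 / (1 - 2 powr (- (q - r)))"
  have D: "0 \<le> D" using K by (simp add: D_def)
  have "2 powr (- r) < (1::real)" "2 powr (- (q - r)) < (1::real)"
    using assms powr_less_mono[of "- r" 0 2] powr_less_mono[of "- (q - r)" 0 2] by simp_all
  then have B: "0 \<le> B" by (simp add: B_def)
  have "expect T (\<lambda>ds. norm (sum_list ds) powr r) \<le> 2 powr r * D * B * expect T (power_sum r)"
    for T :: "'a dtree"
  proof -
    let ?t = "\<lambda>m ds. of_bool (2 powr real_of_int m < norm (sum_list ds :: 'a))"
    let ?w = "\<lambda>m ds. min (power_sum q (ds :: 'a list) / (2 powr real_of_int m) powr q) 1"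
    have "\<exists>S::int set. finite S \<and> (\<forall>u\<in>(\<lambda>ds. norm (sum_list ds)) ` paths T.
        u powr r \<le> 2 powr r * (\<Sum>m\<in>S. 2 powr (real_of_int m * r) * of_bool (2 powr real_of_int m < u)))"
      using assms by (intro dyadic_layers_lower) auto
    then obtain S :: "int set" where S: "finite S"
      "\<And>ds. ds \<in> paths T \<Longrightarrow> norm (sum_list ds) powr r \<le>
        2 powr r * (\<Sum>m\<in>S. 2 powr (real_of_int m * r) * ?t m ds)"
      unfolding ball_simps by blast
    have "expect T (\<lambda>ds. norm (sum_list ds) powr r) \<le>
        expect T (\<lambda>ds. 2 powr r * (\<Sum>m\<in>S. 2 powr (real_of_int m * r) * ?t m ds))"
      by (intro expect_mono S)
    also have "\<dots> = 2 powr r * (\<Sum>m\<in>S. 2 powr (real_of_int m * r) * expect T (?t m))"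
      by (simp only: expect_cmult expect_sum)
    also have "\<dots> \<le> 2 powr r * (\<Sum>m\<in>S. 2 powr (real_of_int m * r) * (D * expect T (?w m)))"
      unfolding D_def using assms by (intro mult_left_mono sum_mono tail_bound) auto
    also have "\<dots> = 2 powr r * D * (\<Sum>m\<in>S. 2 powr (real_of_int m * r) * expect T (?w m))"
      by (simp add: sum_distrib_left mult_ac)
    also have "\<dots> = 2 powr r * D * expect T (\<lambda>ds. \<Sum>m\<in>S. 2 powr (real_of_int m * r) * ?w m ds)"
      by (simp only: expect_cmult expect_sum)
    also have "\<dots> \<le> 2 powr r * D * expect T (\<lambda>ds. B * power_sum r ds)"
    proof (intro mult_left_mono expect_mono)
      fix ds :: "'a list"
      have "(\<Sum>m\<in>S. 2 powr (real_of_int m * r) * ?w m ds) \<le> B * power_sum q ds powr (r / q)"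
        unfolding B_def using S(1) assms by (intro dyadic_layers_upper) auto
      also have "\<dots> \<le> B * power_sum r ds"
        using B assms by (intro mult_left_mono power_sum_powr_le) auto
      finally show "(\<Sum>m\<in>S. 2 powr (real_of_int m * r) * ?w m ds) \<le> B * power_sum r ds" .
    qed (use D in auto)
    finally show ?thesis by (simp only: expect_cmult mult.assoc)
  qed
  then show ?thesis using D B by (intro exI[of _ "2 powr r * D * B"]) auto
qed

section \<open>Haar sums as trees\<close>

text \<open>Disjointness of dyadic intervals of one order becomes a comparison of integers.\<close>

lemma dyadic_interval_iff: "t \<in> dyadic_interval k j \<longleftrightarrow> \<lfloor>t * 2 ^ k\<rfloor> = j - 1"
  unfolding dyadic_interval_def floor_eq_iff by (auto simp: field_simps)

lemma dyadic_interval_Suc: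
  "dyadic_interval k j = dyadic_interval (Suc k) (2 * j - 1) \<union> dyadic_interval (Suc k) (2 * j)"
  "dyadic_interval (Suc k) (2 * j - 1) \<inter> dyadic_interval (Suc k) (2 * j) = {}"
  unfolding dyadic_interval_def by (auto simp: field_simps)

lemma dyadic_interval_subset_unit:
  assumes "j \<in> {1..2 ^ k}"
  shows "dyadic_interval k j \<subseteq> {0..<1}"
proof
  fix t assume t: "t \<in> dyadic_interval k j"
  have "real_of_int j \<le> 2 ^ k" "1 \<le> real_of_int j"
    using assms of_int_le_iff[of j "2 ^ k", where 'a = real] by auto
  then have "real_of_int j / 2 ^ k \<le> 1" "0 \<le> real_of_int (j - 1) / 2 ^ k" by auto
  with t show "t \<in> {0..<1}" unfolding dyadic_interval_def atLeastLessThan_iff by linarith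
qed

lemma haar_block_eq:
  fixes x :: "nat \<Rightarrow> int \<Rightarrow> 'a::banach"
  assumes j: "j \<in> {1..2 ^ k}"
  shows "t \<in> dyadic_interval (Suc k) (2 * j - 1) \<Longrightarrow>
      haar_block x (Suc k) t = 2 powr (real k / 2) *\<^sub>R x (Suc k) j"
    and "t \<in> dyadic_interval (Suc k) (2 * j) \<Longrightarrow>
      haar_block x (Suc k) t = - (2 powr (real k / 2) *\<^sub>R x (Suc k) j)"
proof -
  have single: "haar_block x (Suc k) t = haar (Suc k) j t *\<^sub>R x (Suc k) j"
    if "\<And>i. i \<noteq> j \<Longrightarrow> haar (Suc k) i t = 0" for t
  proof -
    have "haar_block x (Suc k) t = (\<Sum>i\<in>{1..2 ^ k}. if i = j then haar (Suc k) j t *\<^sub>R x (Suc k) j else 0)"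
      unfolding haar_block_def by (intro sum.cong) (auto simp: that)
    then show ?thesis using j by simp
  qed
  {
    assume t: "t \<in> dyadic_interval (Suc k) (2 * j - 1)"
    then have "t \<in> {0..<1}"
      using dyadic_interval_Suc(1)[of k j] dyadic_interval_subset_unit[OF j] by auto
    have "haar (Suc k) i t = 0" if "i \<noteq> j" for i
    proof -
      \<comment> \<open>The left-hand side is the floor of \<open>t * 2 ^ Suc k\<close>; the
        right-hand sides are its values on the two halves of the support of the Haar function with
        index \<open>i\<close>, the second excluded by parity.\<close>
      have "2 * j - 1 - 1 \<noteq> 2 * i - 1 - 1" "2 * j - 1 - 1 \<noteq> 2 * i - 1"
        using that by presburger+
      then show ?thesis using t unfolding haar_def dyadic_interval_iff by metis
    qed
    then show "haar_block x (Suc k) t = 2 powr (real k / 2) *\<^sub>R x (Suc k) j"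
      using t \<open>t \<in> {0..<1}\<close> by (simp add: single haar_def)
  next
    assume t: "t \<in> dyadic_interval (Suc k) (2 * j)"
    then have "t \<in> {0..<1}"
      using dyadic_interval_Suc(1)[of k j] dyadic_interval_subset_unit[OF j] by auto
    have "haar (Suc k) i t = 0" if "i \<noteq> j" for i
    proof -
      have "2 * j - 1 \<noteq> 2 * i - 1 - 1" "2 * j - 1 \<noteq> 2 * i - 1"
        using that by presburger+
      then show ?thesis using t unfolding haar_def dyadic_interval_iff by metis
    qed
    moreover have "t \<notin> dyadic_interval (Suc k) (2 * j - 1)"
      using t dyadic_interval_Suc(2)[of k j] by auto
    ultimately show "haar_block x (Suc k) t = - (2 powr (real k / 2) *\<^sub>R x (Suc k) j)"
      using t \<open>t \<in> {0..<1}\<close> by (simp add: single haar_def)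
  }
qed

text \<open>Levels are counted from 0 here: node (k, j) sits on the dyadic interval (k, j) and carries the
  value of the Haar difference with coefficient (k + 1, j) on that interval.\<close>

primrec haar_tree :: "(nat \<Rightarrow> int \<Rightarrow> 'a::banach) \<Rightarrow> nat \<Rightarrow> nat \<Rightarrow> int \<Rightarrow> 'a dtree" where
  "haar_tree x 0 k j = Leaf"
| "haar_tree x (Suc m) k j = Node (2 powr (real k / 2) *\<^sub>R x (Suc k) j)
     (haar_tree x m (Suc k) (2 * j - 1)) (haar_tree x m (Suc k) (2 * j))"

lemma length_paths_haar_tree: "ds \<in> paths (haar_tree x m k j) \<Longrightarrow> length ds = m"
  by (induction m arbitrary: k j ds) auto

text \<open>The first block is constant on each half of the interval, with opposite signs, and
  halving the length matches the average in \<open>expect\<close>. \<open>F\<close> may be arbitrary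
  because these blocks take finitely many values on the interval.\<close>

lemma has_bochner_integral_haar_tree:
  fixes x :: "nat \<Rightarrow> int \<Rightarrow> 'a::banach"
  assumes "j \<in> {1..2 ^ k}"
  shows "has_bochner_integral lborel
    (\<lambda>t. indicator (dyadic_interval k j) t * F (map (\<lambda>l. haar_block x (Suc l) t) [k..<k + m]))
    (expect (haar_tree x m k j) F / 2 ^ k)"
  using assms
proof (induction m arbitrary: k j F)
  case 0
  have le: "real_of_int (j - 1) / 2 ^ k \<le> real_of_int j / 2 ^ k"
    by (simp add: divide_right_mono)
  have "has_bochner_integral lborel (\<lambda>t. indicator (dyadic_interval k j) t *\<^sub>R F [])
      (measure lborel (dyadic_interval k j) *\<^sub>R F [])"
    using emeasure_lborel_Ico[OF le]
    by (intro has_bochner_integral_indicator) (auto simp: dyadic_interval_def)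
  moreover have "measure lborel (dyadic_interval k j) = 1 / 2 ^ k"
    using measure_lborel_Ico[OF le]
    by (simp add: dyadic_interval_def diff_divide_distrib)
  ultimately show ?case by simp
next
  case (Suc m)
  define d where "d = 2 powr (real k / 2) *\<^sub>R x (Suc k) j"
  have upt: "[k..<k + Suc m] = k # [Suc k..<Suc k + m]"
    by (simp add: upt_conv_Cons)
  have j: "2 * j - 1 \<in> {1..2 ^ Suc k}" "2 * j \<in> {1..2 ^ Suc k}"
    using Suc.prems by auto
  let ?B = "\<lambda>t. map (\<lambda>l. haar_block x (Suc l) t) [Suc k..<Suc k + m]"
  have "has_bochner_integral lborel
      (\<lambda>t. indicator (dyadic_interval (Suc k) (2 * j - 1)) t * F (d # ?B t) +
           indicator (dyadic_interval (Suc k) (2 * j)) t * F (- d # ?B t))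
      (expect (haar_tree x m (Suc k) (2 * j - 1)) (\<lambda>ds. F (d # ds)) / 2 ^ Suc k +
       expect (haar_tree x m (Suc k) (2 * j)) (\<lambda>ds. F (- d # ds)) / 2 ^ Suc k)"
    by (intro has_bochner_integral_add Suc.IH[OF j(1)] Suc.IH[OF j(2)])
  also have "expect (haar_tree x m (Suc k) (2 * j - 1)) (\<lambda>ds. F (d # ds)) / 2 ^ Suc k +
       expect (haar_tree x m (Suc k) (2 * j)) (\<lambda>ds. F (- d # ds)) / 2 ^ Suc k =
       expect (haar_tree x (Suc m) k j) F / 2 ^ k"
    by (simp add: d_def field_simps)
  also have "(\<lambda>t. indicator (dyadic_interval (Suc k) (2 * j - 1)) t * F (d # ?B t) +
           indicator (dyadic_interval (Suc k) (2 * j)) t * F (- d # ?B t)) =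
      (\<lambda>t. indicator (dyadic_interval k j) t *
        F (map (\<lambda>l. haar_block x (Suc l) t) [k..<k + Suc m]))" (is "?lhs = ?rhs")
  proof
    fix t
    consider "t \<in> dyadic_interval (Suc k) (2 * j - 1)" "t \<notin> dyadic_interval (Suc k) (2 * j)"
      | "t \<in> dyadic_interval (Suc k) (2 * j)" "t \<notin> dyadic_interval (Suc k) (2 * j - 1)"
      | "t \<notin> dyadic_interval k j"
      using dyadic_interval_Suc[of k j] by auto
    then show "?lhs t = ?rhs t"
      unfolding upt using haar_block_eq[OF Suc.prems, where t = t and x = x] dyadic_interval_Suc(1)[of k j]
      by cases (auto simp: d_def)
  qed
  finally show ?case .
qed

lemma integral_haar_tree:
  fixes x :: "nat \<Rightarrow> int \<Rightarrow> 'a::banach"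
  shows "(LINT t:{0..<1}|lborel. F (map (\<lambda>l. haar_block x (Suc l) t) [0..<n])) =
    expect (haar_tree x n 0 1) F"
proof -
  have "dyadic_interval 0 1 = {0..<1}" by (simp add: dyadic_interval_def)
  with has_bochner_integral_integral_eq[OF has_bochner_integral_haar_tree[of 1 0 F x n]]
  show ?thesis by (simp add: set_lebesgue_integral_def)
qed

lemma sum_list_haar_blocks:
  "sum_list (map (\<lambda>l. haar_block x (Suc l) t) [0..<n]) = haar_sum x n t"
  unfolding haar_sum_def
  by (induction n) (simp_all add: add.commute)

lemma Lq_norm_powr:
  assumes "0 < q"
  shows "Lq_norm q f powr q = (LINT t:{0..<1}|lborel. norm (f t) powr q)"
proof -
  have "0 \<le> (LINT t:{0..<1}|lborel. norm (f t) powr q)"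
    unfolding set_lebesgue_integral_def by (intro integral_nonneg_AE) auto
  then show ?thesis using assms by (simp add: Lq_norm_def powr_powr)
qed

lemma Lq_norm_haar_sum:
  fixes x :: "nat \<Rightarrow> int \<Rightarrow> 'a::banach"
  assumes "0 < q"
  shows "Lq_norm q (haar_sum x n) powr q =
    expect (haar_tree x n 0 1) (\<lambda>ds. norm (sum_list ds) powr q)"
  unfolding Lq_norm_powr[OF assms] sum_list_haar_blocks[symmetric]
  by (rule integral_haar_tree)

lemma sum_Lq_norm_haar_block:
  fixes x :: "nat \<Rightarrow> int \<Rightarrow> 'a::banach"
  assumes "0 < q"
  shows "(\<Sum>k\<in>{1..n}. Lq_norm q (haar_block x k) powr q) =
    expect (haar_tree x n 0 1) (power_sum q)"
proof -
  have "Lq_norm q (haar_block x (Suc l)) powr q =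
      expect (haar_tree x n 0 1) (\<lambda>ds. norm (ds ! l) powr q)" if "l < n" for l
    using integral_haar_tree[of "\<lambda>ds. norm (ds ! l) powr q" x n] that
    by (simp add: Lq_norm_powr[OF assms])
  then have "(\<Sum>l<n. Lq_norm q (haar_block x (Suc l)) powr q) =
      expect (haar_tree x n 0 1) (\<lambda>ds. \<Sum>l<n. norm (ds ! l) powr q)"
    by (simp add: expect_sum)
  also have "\<dots> = expect (haar_tree x n 0 1) (power_sum q)"
    by (intro expect_cong)
      (auto simp: power_sum_def sum_list_sum_nth atLeast0LessThan dest: length_paths_haar_tree)
  finally show ?thesis
    by (simp only: One_nat_def sum.atLeast_Suc_atMost_Suc_shift atLeast0LessThan
        sum.atLeast1_atMost_eq)
qed

section \<open>From trees back to Haar coefficients\<close>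

text \<open>Nodes are numbered like dyadic intervals: \<open>j\<close> has children
  \<open>2 * j - 1\<close> and \<open>2 * j\<close>, so its parent is \<open>(j + 1) div 2\<close>
  and odd numbers are left children.\<close>

primrec subtree_at :: "'a dtree \<Rightarrow> nat \<Rightarrow> int \<Rightarrow> 'a dtree" where
  "subtree_at T 0 j = T"
| "subtree_at T (Suc k) j = (case subtree_at T k ((j + 1) div 2) of
     Leaf \<Rightarrow> Leaf | Node x L R \<Rightarrow> if odd j then L else R)"

text \<open>The power of 2 cancels the normalisation of the Haar functions; coefficients of order
  \<open>k\<close> sit at depth \<open>k - 1\<close>.\<close>

definition haar_coeffs :: "'a::real_vector dtree \<Rightarrow> nat \<Rightarrow> int \<Rightarrow> 'a" where
  "haar_coeffs T k j = (case subtree_at T (k - 1) j of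
     Leaf \<Rightarrow> 0 | Node x L R \<Rightarrow> 2 powr (- (real (k - 1) / 2)) *\<^sub>R x)"

text \<open>Every tree of constant depth comes from a Haar sum, which lets weak Haar type be applied
  to the trees built from stopped and padded ones. The claim concerns subtrees so that the induction
  can descend.\<close>

lemma haar_tree_haar_coeffs:
  fixes T :: "'a::banach dtree"
  assumes "\<And>ds. ds \<in> paths (subtree_at T k j) \<Longrightarrow> length ds = m"
  shows "haar_tree (haar_coeffs T) m k j = subtree_at T k j"
  using assms
proof (induction m arbitrary: k j)
  case 0
  show ?case
  proof (cases "subtree_at T k j")
    case (Node x L R)
    obtain ds where "ds \<in> paths L" using paths_nonempty by blast
    then have "x # ds \<in> paths (subtree_at T k j)" by (simp add: Node)
    from "0.prems"[OF this] show ?thesis by simp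
  qed simp
next
  case (Suc m)
  show ?case
  proof (cases "subtree_at T k j")
    case Leaf
    then show ?thesis using Suc.prems[of "[]"] by simp
  next
    case (Node x L R)
    have L: "subtree_at T (Suc k) (2 * j - 1) = L" and R: "subtree_at T (Suc k) (2 * j) = R"
      using Node by simp_all
    have "length ds = m" if "ds \<in> paths L" for ds
      using Suc.prems[of "x # ds"] that by (simp add: Node)
    moreover have "length ds = m" if "ds \<in> paths R" for ds
      using Suc.prems[of "- x # ds"] that by (simp add: Node)
    ultimately show ?thesis
      using Suc.IH[of "Suc k" "2 * j - 1"] Suc.IH[of "Suc k" "2 * j"]
      unfolding L R by (simp add: haar_coeffs_def Node powr_add[symmetric])
  qed
qed

section \<open>Extrapolation\<close>

lemma weak_haar_type_imp_weak_tree_type: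
  assumes "weak_haar_type TYPE('a::banach) p"
  shows "\<exists>K\<ge>0. weak_tree_type TYPE('a) K p"
proof -
  obtain c where c: "0 \<le> c" "\<And>n x. 1 \<le> n \<Longrightarrow> Lq_norm 2 (haar_sum (x :: nat \<Rightarrow> int \<Rightarrow> 'a) n) \<le>
      c * real n powr (1 / p - 1 / 2) * (\<Sum>k\<in>{1..n}. Lq_norm 2 (haar_block x k) powr 2) powr (1 / 2)"
    using assms unfolding weak_haar_type_def by blast
  have "expect T (\<lambda>ds. (norm (sum_list ds))\<^sup>2) \<le> c\<^sup>2 * real N powr (2 / p - 1) * expect T (power_sum 2)"
    if N: "1 \<le> N" and T: "\<forall>ds\<in>paths T. length ds = N" for N and T :: "'a dtree"
  proof -
    define x where "x = haar_coeffs T"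
    have tree: "haar_tree x N 0 1 = T"
      using haar_tree_haar_coeffs[of T 0 1 N] T by (simp add: x_def)
    have nonneg: "0 \<le> expect T (power_sum 2)" by (rule expect_nonneg) simp
    have "expect T (\<lambda>ds. (norm (sum_list ds))\<^sup>2) = Lq_norm 2 (haar_sum x N) powr 2"
      by (subst Lq_norm_haar_sum) (simp_all add: tree)
    also have "\<dots> \<le> (c * real N powr (1 / p - 1 / 2) * expect T (power_sum 2) powr (1 / 2)) powr 2"
      using c(2)[OF N, of x] sum_Lq_norm_haar_block[of 2 x N]
      by (intro powr_mono2) (auto simp: tree Lq_norm_def)
    also have "\<dots> = c powr 2 * real N powr ((1 / p - 1 / 2) * 2) * expect T (power_sum 2)"
      using c(1) N nonneg by (simp only: powr_mult powr_powr powr_ge_zero mult_nonneg_nonneg) simp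
    also have "(1 / p - 1 / 2) * 2 = 2 / p - 1" by simp
    finally show ?thesis using c(1) by simp
  qed
  then show ?thesis
    unfolding weak_tree_type_def by (intro exI[of _ "c\<^sup>2"]) auto
qed

theorem theorem1p4:
  fixes p r :: real
  assumes "1 \<le> p" and "p < 2" and "1 \<le> r" and "r < p"
    and "weak_haar_type TYPE('a::banach) p"
  shows "haar_type TYPE('a) r"
proof -
  obtain K where "0 \<le> K" "weak_tree_type TYPE('a) K p"
    using weak_haar_type_imp_weak_tree_type[OF assms(5)] by blast
  \<comment> \<open>The auxiliary exponent \<open>q\<close> is the midpoint of \<open>r\<close> and
    \<open>p\<close>.\<close>
  moreover have "0 < r" "r < (r + p) / 2" "(r + p) / 2 < p" using assms by simp_all
  ultimately obtain C where C: "0 \<le> C" "\<And>T :: 'a dtree.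
      expect T (\<lambda>ds. norm (sum_list ds) powr r) \<le> C * expect T (power_sum r)"
    using moment_bound[of K p r "(r + p) / 2"] assms(2) by blast
  \<comment> \<open>\<open>C\<close> bounds the \<open>r\<close>-th powers, so its
    \<open>r\<close>-th root serves as the Haar type constant.\<close>
  have "Lq_norm r (haar_sum x n) \<le>
      C powr (1 / r) * (\<Sum>k\<in>{1..n}. Lq_norm r (haar_block x k) powr r) powr (1 / r)"
    for n and x :: "nat \<Rightarrow> int \<Rightarrow> 'a"
  proof -
    have "0 \<le> Lq_norm r (haar_sum x n)"
      by (simp add: Lq_norm_def)
    then have "Lq_norm r (haar_sum x n) = (Lq_norm r (haar_sum x n) powr r) powr (1 / r)"
      using \<open>0 < r\<close> by (simp add: powr_powr)
    also have "\<dots> \<le> (C * expect (haar_tree x n 0 1) (power_sum r)) powr (1 / r)"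
      unfolding Lq_norm_haar_sum[OF \<open>0 < r\<close>]
      using C(2) \<open>0 < r\<close> by (intro powr_mono2 expect_nonneg) auto
    also have "\<dots> = C powr (1 / r) * expect (haar_tree x n 0 1) (power_sum r) powr (1 / r)"
      by (rule powr_mult)
    finally show ?thesis
      by (simp only: sum_Lq_norm_haar_block[OF \<open>0 < r\<close>])
  qed
  then show ?thesis
    unfolding haar_type_def by (intro exI[of _ "C powr (1 / r)"]) auto
qed

end
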